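(* Let $\mathcal{X}$ be a real Hilbert space, let $f$, $g$, $\Psi=f+g$, $L_f>0$ be as in the context. In APGD (see context), suppose that $0<\gamma\le\frac{1}{L_f}$, $a_0=0$, $a_t\ge 1$ for every $t\ge 1$, $a_{t+1}^2-a_{t+1}\le a_t^2$ for every $t\ge 0$, and $a_t\to\infty$. Then $(z^t)_{t\ge 0}$ is bounded, and there exists $x^\star\in\arg\min\Psi$ such that $(x^t)_{t\ge 0}$ and $(y^t)_{t\ge 0}$ both converge weakly to $x^\star$.
   Context: Setting: $\mathcal{X}$ is a real Hilbert space; $f:\mathcal{X}\to\mathbb{R}$ is convex, differentiable and $L_f$-smooth (i.e. $\nabla f$ is $L_f$-Lipschitz continuous) with $L_f>0$; $g:\mathcal{X}\to\mathbb{R}\cup\{+\infty\}$ is proper, lower semicontinuous and convex. $\Psi:=f+g$ is assumed to have a minimizer. $\mathrm{prox}_\phi(x):=\arg\min_{y}\{\phi(y)+\frac12\|y-x\|^2\}$. APGD: given $\gamma>0$, a real sequence $(a_t)_{t\ge0}$ with $a_t\ge 1$ for every $t\ge 1$, and $z^0=x^0\in\mathcal{X}$, iterate for $t\ge 0$: $y^{t}:=(1-\frac{1}{a_{t+1}})x^{t}+\frac{1}{a_{t+1}}z^{t}$; $z^{t+1}:=\mathrm{prox}_{a_{t+1}\gamma g}\big(z^t-a_{t+1}\gamma\nabla f(y^t)\big)$; $x^{t+1}:=(1-\frac{1}{a_{t+1}})x^{t}+\frac{1}{a_{t+1}}z^{t+1}$. *)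

theory Defs
  imports "HOL-Analysis.Analysis"
begin

text \<open>
  Extended-valued functions are modelled as maps into \<^typ>\<open>ereal\<close>; properness excludes the
  value \<open>-\<infinity>\<close>, so that the sums below never involve \<open>\<infinity> - \<infinity>\<close>.
\<close>

definition proper_fun :: "('a \<Rightarrow> ereal) \<Rightarrow> bool" where
  "proper_fun g \<longleftrightarrow> (\<forall>x. g x \<noteq> -\<infinity>) \<and> (\<exists>x. g x \<noteq> \<infinity>)"

definition lower_semicontinuous :: "('a::topological_space \<Rightarrow> ereal) \<Rightarrow> bool" where
  "lower_semicontinuous g \<longleftrightarrow> (\<forall>x. g x \<le> Liminf (nhds x) g)"

text \<open>The library's \<^const>\<open>convex_on\<close> only covers real-valued functions.\<close>

definition convex_ereal :: "('a::real_vector \<Rightarrow> ereal) \<Rightarrow> bool" where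
  "convex_ereal g \<longleftrightarrow>
    (\<forall>x y u v. 0 < u \<longrightarrow> 0 < v \<longrightarrow> u + v = 1 \<longrightarrow>
      g (u *\<^sub>R x + v *\<^sub>R y) \<le> ereal u * g x + ereal v * g y)"

text \<open>
  By the Riesz representation theorem the gradient exists, and is unique, wherever a function on
  a Hilbert space is Frechet differentiable.
\<close>

definition gradient :: "('a::real_inner \<Rightarrow> real) \<Rightarrow> 'a \<Rightarrow> 'a" where
  "gradient f x = (THE D. GDERIV f x :> D)"

definition minimizers :: "('a \<Rightarrow> ereal) \<Rightarrow> 'a set" where
  "minimizers \<phi> = {x. is_arg_min \<phi> (\<lambda>_. True) x}"

text \<open>
  For proper, lower semicontinuous, convex \<open>\<phi>\<close> on a Hilbert space the minimizer exists and is
  unique, so the choice made by \<^const>\<open>arg_min\<close> is immaterial.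
\<close>

definition prox :: "('a::real_inner \<Rightarrow> ereal) \<Rightarrow> 'a \<Rightarrow> 'a" where
  "prox \<phi> x = arg_min (\<lambda>y. \<phi> y + ereal ((norm (y - x))\<^sup>2 / 2)) (\<lambda>_. True)"

definition apgd ::
  "('a::real_inner \<Rightarrow> real) \<Rightarrow> ('a \<Rightarrow> ereal) \<Rightarrow> real \<Rightarrow> (nat \<Rightarrow> real) \<Rightarrow>
    (nat \<Rightarrow> 'a) \<Rightarrow> (nat \<Rightarrow> 'a) \<Rightarrow> (nat \<Rightarrow> 'a) \<Rightarrow> bool" where
  "apgd f g \<gamma> a x y z \<longleftrightarrow>
    z 0 = x 0 \<and>
    (\<forall>t. y t = (1 - 1 / a (t + 1)) *\<^sub>R x t + (1 / a (t + 1)) *\<^sub>R z t) \<and>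
    (\<forall>t. z (t + 1) =
      prox (\<lambda>u. ereal (a (t + 1) * \<gamma>) * g u) (z t - (a (t + 1) * \<gamma>) *\<^sub>R gradient f (y t))) \<and>
    (\<forall>t. x (t + 1) = (1 - 1 / a (t + 1)) *\<^sub>R x t + (1 / a (t + 1)) *\<^sub>R z (t + 1))"

definition weakly_converges :: "(nat \<Rightarrow> 'a::real_normed_vector) \<Rightarrow> 'a \<Rightarrow> bool" where
  "weakly_converges s l \<longleftrightarrow>
    (\<forall>\<phi> :: 'a \<Rightarrow> real. bounded_linear \<phi> \<longrightarrow> (\<lambda>n. \<phi> (s n)) \<longlonglongrightarrow> \<phi> l)"

end

theory Submission
  imports Defs
begin

text \<open>
  For a minimizer \<open>u\<close> with value \<open>m\<close>, the energy
  \<open>a\<^sub>t\<^sup>2 \<gamma> (\<Psi>(x\<^sub>t) - m) + \<parallel>z\<^sub>t - u\<parallel>\<^sup>2 / 2\<close> is nonincreasing, so \<open>z\<close> and \<open>x\<close> are bounded and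
  \<open>\<Psi>(x\<^sub>t) \<longlonglongrightarrow> m\<close>. The energies of two minimizers \<open>u\<close>, \<open>v\<close> differ by an affine function of
  \<open>\<langle>z\<^sub>t, u - v\<rangle>\<close>, which therefore converges. Since \<open>a\<^sub>t \<le> t\<close>, the weights \<open>1 / a\<^sub>t\<close> are not summable,
  and the averages \<open>\<langle>x\<^sub>t, u - v\<rangle>\<close> converge to the same limit; hence \<open>x\<close> has only one weak cluster
  point. In place of weak compactness the argument uses asymptotic centres: the minimizer \<open>p\<close> of
  \<open>w \<mapsto> limsup \<parallel>x\<^sub>t - w\<parallel>\<^sup>2\<close> satisfies \<open>\<langle>x\<^sub>t - p, h\<rangle> < e\<close> infinitely often for all \<open>h\<close> and \<open>e > 0\<close>,
  and this one-sided property of a cluster point is all that is needed.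
\<close>

lemma midpoint_norm_square:
  fixes u v w :: "'a::real_inner"
  shows "(norm ((1/2) *\<^sub>R (u + v) - w))\<^sup>2
    = (norm (u - w))\<^sup>2 / 2 + (norm (v - w))\<^sup>2 / 2 - (norm (u - v))\<^sup>2 / 4"
  unfolding power2_norm_eq_inner
  by (simp add: inner_diff inner_add algebra_simps inner_commute field_simps)

subsection \<open>Existence of minimizers and the proximal operator\<close>

text \<open>The midpoint of two near-minimizers cannot fall below the infimum, so the quadratic gap
  in \<open>mid\<close> forces a minimizing sequence to be Cauchy. Real bounds \<open>r\<close>,
  \<open>s\<close> replace values of \<open>h\<close> to keep infinities out of the arithmetic. The
  lemma serves both the proximal objective and the asymptotic centre.\<close>

lemma midpoint_strongly_convex_minimizer:
  fixes h :: "'a::{real_inner, complete_space} \<Rightarrow> ereal"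
  assumes lower: "\<And>w. ereal m \<le> h w"
    and fin: "h w0 \<noteq> \<infinity>"
    and lsc: "\<And>s p c. s \<longlonglongrightarrow> p \<Longrightarrow> (\<forall>\<^sub>F n in sequentially. h (s n) \<le> ereal c) \<Longrightarrow> h p \<le> ereal c"
    and mid: "\<And>u v r s. h u \<le> ereal r \<Longrightarrow> h v \<le> ereal s \<Longrightarrow>
      h ((1/2) *\<^sub>R (u + v)) \<le> ereal ((r + s) / 2 - (norm (u - v))\<^sup>2 / 8)"
  obtains p where "\<And>w. h p \<le> h w"
proof -
  have "ereal m \<le> Inf (range h)" using lower by (auto intro: Inf_greatest)
  moreover have "Inf (range h) \<le> h w0" by (auto intro: Inf_lower)
  ultimately obtain i where i: "Inf (range h) = ereal i"
    using fin by (cases "Inf (range h)") auto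
  have il: "ereal i \<le> h w" for w unfolding i[symmetric] by (auto intro: Inf_lower)
  define e where "e n = 1 / (real n + 1)" for n
  have e0: "e \<longlonglongrightarrow> 0" unfolding e_def
    using LIMSEQ_inverse_real_of_nat by (simp add: inverse_eq_divide add.commute)
  have epos: "e n > 0" for n unfolding e_def by simp
  have "\<exists>w. h w \<le> ereal (i + e n)" for n
  proof -
    have "Inf (range h) < ereal (i + e n)" using i epos by simp
    then show ?thesis unfolding Inf_less_iff by (auto intro: less_imp_le)
  qed
  then obtain s where s: "\<And>n. h (s n) \<le> ereal (i + e n)" by metis
  \<comment> \<open>\<open>mid\<close> gives
    \<open>i \<le> i + (e n + e k) / 2 - (norm (s n - s k))\<^sup>2 / 8\<close>.\<close>
  have d: "(norm (s n - s k))\<^sup>2 \<le> 4 * (e n + e k)" for n k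
    using order_trans[OF il mid[OF s[of n] s[of k]]] by (simp add: field_simps)
  have "Cauchy s"
  proof (rule metric_CauchyI)
    fix c :: real assume c: "0 < c"
    have "\<forall>\<^sub>F n in sequentially. e n < c\<^sup>2 / 8"
      using order_tendstoD(2)[OF e0, of "c\<^sup>2 / 8"] c by simp
    then obtain N where N: "\<And>n. n \<ge> N \<Longrightarrow> e n < c\<^sup>2 / 8"
      unfolding eventually_sequentially by auto
    have "dist (s n) (s k) < c" if "n \<ge> N" "k \<ge> N" for n k
    proof -
      have "(norm (s n - s k))\<^sup>2 < c\<^sup>2"
        using d[of n k] N[OF that(1)] N[OF that(2)] by simp
      then show ?thesis unfolding dist_norm using c by (simp add: power2_less_imp_less)
    qed
    then show "\<exists>N. \<forall>n\<ge>N. \<forall>k\<ge>N. dist (s n) (s k) < c" by blast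
  qed
  then obtain p where p: "s \<longlonglongrightarrow> p"
    using Cauchy_convergent convergent_def by blast
  have "h p \<le> ereal i + ereal c" if c: "c > 0" for c
  proof -
    have "\<forall>\<^sub>F n in sequentially. h (s n) \<le> ereal (i + c)"
      using order_tendstoD(2)[OF e0 c]
    proof eventually_elim
      case (elim n)
      then show ?case by (intro order_trans[OF s]) simp
    qed
    from lsc[OF p this] show ?thesis by simp
  qed
  then have "h p \<le> ereal i" by (rule ereal_le_epsilon2)
  then show ?thesis using that il order_trans by blast
qed

lemma lower_semicontinuous_sublevel:
  assumes "lower_semicontinuous g" "s \<longlonglongrightarrow> p" "\<forall>\<^sub>F n in sequentially. g (s n) \<le> c"
  shows "g p \<le> c"
proof (rule ccontr)
  assume "\<not> g p \<le> c"
  then have "c < Liminf (nhds p) g"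
    using assms(1) unfolding lower_semicontinuous_def by (metis not_le order.strict_trans2)
  then have "\<forall>\<^sub>F w in nhds p. c < g w"
    by (rule less_LiminfD)
  then have "\<forall>\<^sub>F n in sequentially. c < g (s n)"
    using assms(2) by (rule eventually_compose_filterlim)
  with assms(3) have "\<forall>\<^sub>F n in sequentially. False"
    by eventually_elim auto
  then show False by simp
qed

lemma lower_semicontinuousI_less:
  assumes "\<And>w c. c < g w \<Longrightarrow> \<forall>\<^sub>F v in nhds w. c < g v"
  shows "lower_semicontinuous g"
  unfolding lower_semicontinuous_def le_Liminf_iff using assms by auto

lemma convex_erealD:
  assumes "convex_ereal g" "g u \<le> ereal r" "g v \<le> ereal s" "0 < t" "t < 1"
  shows "g ((1 - t) *\<^sub>R u + t *\<^sub>R v) \<le> ereal ((1 - t) * r + t * s)"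
proof -
  have "g ((1 - t) *\<^sub>R u + t *\<^sub>R v) \<le> ereal (1 - t) * g u + ereal t * g v"
    using assms unfolding convex_ereal_def by auto
  also have "\<dots> \<le> ereal (1 - t) * ereal r + ereal t * ereal s"
    using assms by (intro add_mono ereal_mult_left_mono) auto
  finally show ?thesis by simp
qed

lemma proper_fun_finite_point:
  assumes "proper_fun g" obtains w b where "g w = ereal b"
proof -
  from assms obtain w where w: "g w \<noteq> \<infinity>" "g w \<noteq> -\<infinity>" unfolding proper_fun_def by auto
  then show ?thesis using that by (cases "g w") auto
qed

text \<open>Lower semicontinuity bounds \<open>g\<close> below on a ball around a point of finite
  value. Convexity carries this outwards: a value far below a steep cone would drag down the points
  of the segment that still lie in the ball. The bound is what keeps the proximal objective bounded
  below.\<close>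

lemma convex_lsc_linear_lower_bound:
  fixes g :: "'a::real_inner \<Rightarrow> ereal"
  assumes "proper_fun g" "lower_semicontinuous g" "convex_ereal g"
  obtains b K where "K \<ge> 0" "\<And>w. ereal (b - K * norm (w - x)) \<le> g w"
proof -
  obtain w0 b where b: "g w0 = ereal b" using assms(1) by (rule proper_fun_finite_point)
  have "ereal b \<le> Liminf (nhds w0) g"
    using assms(2) b unfolding lower_semicontinuous_def by metis
  then have "\<forall>\<^sub>F w in nhds w0. ereal (b - 1) < g w"
    unfolding le_Liminf_iff by (simp add: ereal_less_eq)
  then obtain r where r: "r > 0" "\<And>w. dist w w0 < r \<Longrightarrow> ereal (b - 1) < g w"
    unfolding eventually_nhds_metric by auto
  have bnd: "ereal (b - 1 - 2 / r * norm (w - w0)) \<le> g w" for w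
  proof (rule ccontr)
    assume "\<not> ?thesis"
    then have gw: "g w < ereal (b - 1 - 2 / r * norm (w - w0))" by simp
    have "\<not> dist w w0 < r"
    proof
      assume "dist w w0 < r"
      from r(2)[OF this] gw have "ereal (b - 1) < ereal (b - 1 - 2 / r * norm (w - w0))"
        by (rule order.strict_trans)
      then show False using r(1) by (simp add: field_simps)
    qed
    then have d: "norm (w - w0) \<ge> r" by (simp add: dist_norm)
    \<comment> \<open>This \<open>t\<close> places the point of the segment at distance
      \<open>r / 2\<close> from \<open>w0\<close>, inside the ball, and the slope
      \<open>2 / r\<close> then contributes a drop of exactly 1.\<close>
    define t where "t = r / (2 * norm (w - w0))"
    have dp: "norm (w - w0) > 0" using d r(1) by linarith
    have t: "0 < t" "t < 1" using d dp r(1) unfolding t_def by (auto simp: field_simps)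
    have "(1 - t) *\<^sub>R w0 + t *\<^sub>R w - w0 = t *\<^sub>R (w - w0)" by (simp add: algebra_simps)
    then have "dist ((1 - t) *\<^sub>R w0 + t *\<^sub>R w) w0 = t * norm (w - w0)"
      unfolding dist_norm using t by simp
    also have "\<dots> < r" unfolding t_def using r(1) dp by simp
    finally have "ereal (b - 1) < g ((1 - t) *\<^sub>R w0 + t *\<^sub>R w)" by (rule r(2))
    also have "\<dots> \<le> ereal ((1 - t) * b + t * (b - 1 - 2 / r * norm (w - w0)))"
      by (rule convex_erealD[OF assms(3) _ _ t]) (use b gw in auto)
    finally have "b - 1 < b - t - t * (2 / r * norm (w - w0))" by (simp add: algebra_simps)
    moreover have "t * (2 / r * norm (w - w0)) = 1" using r(1) dp unfolding t_def by (simp add: field_simps)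
    ultimately show False using t by linarith
  qed
  show ?thesis
  proof (rule that[of "2 / r" "b - 1 - 2 / r * norm (x - w0)"])
    fix w
    have "2 / r * norm (w - w0) \<le> 2 / r * (norm (w - x) + norm (x - w0))"
      using r(1) norm_triangle_ineq[of "w - x" "x - w0"] by (intro mult_left_mono) auto
    then have "ereal (b - 1 - 2 / r * norm (x - w0) - 2 / r * norm (w - x))
      \<le> ereal (b - 1 - 2 / r * norm (w - w0))" by (simp add: algebra_simps)
    also note bnd[of w]
    finally show "ereal (b - 1 - 2 / r * norm (x - w0) - 2 / r * norm (w - x)) \<le> g w" .
  qed (use r in simp)
qed

lemma ereal_add_le_iff:
  fixes b :: ereal
  shows "b + ereal q \<le> ereal c \<longleftrightarrow> b \<le> ereal (c - q)"
  by (cases b) auto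

text \<open>Half the squared distance supplies the midpoint gap with constant 1/8, so a minimizer
  exists and the choice made by \<open>arg_min\<close> is a genuine one. Uniqueness does not enter
  the argument.\<close>

lemma prox_is_minimizer:
  fixes g :: "'a::{real_inner, complete_space} \<Rightarrow> ereal"
  assumes g: "proper_fun g" "lower_semicontinuous g" "convex_ereal g"
  shows "g (prox g x) + ereal ((norm (prox g x - x))\<^sup>2 / 2) \<le> g w + ereal ((norm (w - x))\<^sup>2 / 2)"
proof -
  define h where "h w = g w + ereal ((norm (w - x))\<^sup>2 / 2)" for w
  obtain b K where K: "K \<ge> 0" and bK: "\<And>w. ereal (b - K * norm (w - x)) \<le> g w"
    using convex_lsc_linear_lower_bound[OF g] by blast
  obtain w0 b0 where w0: "g w0 = ereal b0" using g(1) by (rule proper_fun_finite_point)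
  obtain p where p: "\<And>w. h p \<le> h w"
  proof (rule midpoint_strongly_convex_minimizer[of "b - K\<^sup>2 / 2" h])
    fix w
    \<comment> \<open>Completing the square: \<open>b - K * d + d\<^sup>2 / 2\<close> has its least
      value \<open>b - K\<^sup>2 / 2\<close> at \<open>d = K\<close>.\<close>
    have "0 \<le> (K - norm (w - x))\<^sup>2" by simp
    then have "ereal (b - K\<^sup>2 / 2) \<le> ereal (b - K * norm (w - x)) + ereal ((norm (w - x))\<^sup>2 / 2)"
      by (simp add: power2_diff)
    also have "\<dots> \<le> h w" unfolding h_def by (intro add_right_mono bK)
    finally show "ereal (b - K\<^sup>2 / 2) \<le> h w" .
  next
    show "h w0 \<noteq> \<infinity>" using w0 by (simp add: h_def)
  next
    fix s p c assume sp: "s \<longlonglongrightarrow> p" and ev: "\<forall>\<^sub>F n in sequentially. h (s n) \<le> ereal c"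
    have lim: "(\<lambda>n. (norm (s n - x))\<^sup>2 / 2) \<longlonglongrightarrow> (norm (p - x))\<^sup>2 / 2"
      by (intro tendsto_intros sp) auto
    have "g p \<le> ereal (c - (norm (p - x))\<^sup>2 / 2) + ereal e" if e: "e > 0" for e
    proof -
      have "\<forall>\<^sub>F n in sequentially. (norm (p - x))\<^sup>2 / 2 - e < (norm (s n - x))\<^sup>2 / 2"
        using order_tendstoD(1)[OF lim, of "(norm (p - x))\<^sup>2 / 2 - e"] e by simp
      with ev have "\<forall>\<^sub>F n in sequentially. g (s n) \<le> ereal (c - (norm (p - x))\<^sup>2 / 2 + e)"
      proof eventually_elim
        case (elim n)
        from elim(1) have "g (s n) \<le> ereal (c - (norm (s n - x))\<^sup>2 / 2)"
          by (simp add: h_def ereal_add_le_iff)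
        also have "\<dots> \<le> ereal (c - (norm (p - x))\<^sup>2 / 2 + e)" using elim(2) by simp
        finally show ?case .
      qed
      from lower_semicontinuous_sublevel[OF g(2) sp this] show ?thesis by simp
    qed
    then have "g p \<le> ereal (c - (norm (p - x))\<^sup>2 / 2)" by (rule ereal_le_epsilon2)
    then show "h p \<le> ereal c" by (simp add: h_def ereal_add_le_iff)
  next
    fix u v r s assume "h u \<le> ereal r" "h v \<le> ereal s"
    then have gu: "g u \<le> ereal (r - (norm (u - x))\<^sup>2 / 2)" "g v \<le> ereal (s - (norm (v - x))\<^sup>2 / 2)"
      by (auto simp: h_def ereal_add_le_iff)
    have "g ((1/2) *\<^sub>R (u + v)) \<le> ereal ((1 - 1/2) * (r - (norm (u - x))\<^sup>2 / 2) + 1/2 * (s - (norm (v - x))\<^sup>2 / 2))"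
      using convex_erealD[OF g(3) gu, of "1/2"] by (simp add: scaleR_add_right)
    also have "\<dots> = ereal ((r + s) / 2 - (norm (u - v))\<^sup>2 / 8 - (norm ((1/2) *\<^sub>R (u + v) - x))\<^sup>2 / 2)"
      unfolding midpoint_norm_square by (simp add: field_simps)
    finally show "h ((1/2) *\<^sub>R (u + v)) \<le> ereal ((r + s) / 2 - (norm (u - v))\<^sup>2 / 8)"
      by (simp add: h_def ereal_add_le_iff)
  qed blast
  have "is_arg_min h (\<lambda>_. True) p" using p by (auto simp: is_arg_min_def not_less)
  then have "is_arg_min h (\<lambda>_. True) (prox g x)"
    unfolding prox_def arg_min_def h_def[symmetric] by (rule someI[of "is_arg_min h (\<lambda>_. True)"])
  then show ?thesis unfolding is_arg_min_def h_def by (auto simp: not_less)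
qed

text \<open>This says that \<open>x - prox g x\<close> is a subgradient of \<open>g\<close> at the
  proximal point. It follows by comparing that point with nearby points of the segment towards
  \<open>u\<close>, dividing by the step length \<open>t\<close> and letting \<open>t\<close> tend
  to 0.\<close>

lemma prox_variational:
  fixes g :: "'a::{real_inner, complete_space} \<Rightarrow> ereal"
  assumes g: "proper_fun g" "lower_semicontinuous g" "convex_ereal g"
  obtains r where "g (prox g x) = ereal r"
    and "\<And>u s. g u \<le> ereal s \<Longrightarrow> r + inner (x - prox g x) (u - prox g x) \<le> s"
proof -
  define p where "p = prox g x"
  note m = prox_is_minimizer[OF g, of x, folded p_def]
  obtain w0 b0 where w0: "g w0 = ereal b0" using g(1) by (rule proper_fun_finite_point)
  have "g p \<noteq> \<infinity>" using m[of w0] w0 by auto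
  moreover have "g p \<noteq> -\<infinity>" using g(1) by (auto simp: proper_fun_def)
  ultimately obtain r where r: "g p = ereal r" by (cases "g p") auto
  have "r + inner (x - p) (u - p) \<le> s" if us: "g u \<le> ereal s" for u s
  proof -
    have ineq: "r + inner (x - p) (u - p) - s \<le> t * ((norm (u - p))\<^sup>2 / 2)" if t: "0 < t" "t < 1" for t
    proof -
      let ?w = "(1 - t) *\<^sub>R p + t *\<^sub>R u"
      have "ereal (r + (norm (p - x))\<^sup>2 / 2) \<le> g ?w + ereal ((norm (?w - x))\<^sup>2 / 2)"
        using m[of ?w] r by simp
      also have "\<dots> \<le> ereal ((1 - t) * r + t * s) + ereal ((norm (?w - x))\<^sup>2 / 2)"
        using r us t by (intro add_right_mono convex_erealD[OF g(3)]) auto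
      finally have le: "r + (norm (p - x))\<^sup>2 / 2 \<le> (1 - t) * r + t * s + (norm (?w - x))\<^sup>2 / 2" by simp
      have w: "?w - x = (p - x) + t *\<^sub>R (u - p)" by (simp add: algebra_simps)
      have "(norm (?w - x))\<^sup>2 = (norm (p - x))\<^sup>2 - 2 * t * inner (x - p) (u - p) + t\<^sup>2 * (norm (u - p))\<^sup>2"
        unfolding w power2_norm_eq_inner
        by (simp add: inner_diff inner_add algebra_simps inner_commute power2_eq_square)
      with le have "t * (r + inner (x - p) (u - p) - s) \<le> t * (t * ((norm (u - p))\<^sup>2 / 2))"
        by (simp add: algebra_simps power2_eq_square)
      then show ?thesis using t by simp
    qed
    have "((\<lambda>t. t * ((norm (u - p))\<^sup>2 / 2)) \<longlongrightarrow> 0 * ((norm (u - p))\<^sup>2 / 2)) (at_right (0::real))"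
      by (intro tendsto_intros)
    moreover have "\<forall>\<^sub>F t in at_right (0::real). r + inner (x - p) (u - p) - s \<le> t * ((norm (u - p))\<^sup>2 / 2)"
      using eventually_at_right_less[of 0] eventually_at_right_real[of 0 1, simplified]
      by (rule eventually_elim2) (use ineq in auto)
    ultimately have "r + inner (x - p) (u - p) - s \<le> 0 * ((norm (u - p))\<^sup>2 / 2)"
      by (rule tendsto_lowerbound) simp
    then show ?thesis by simp
  qed
  then show ?thesis using that r unfolding p_def by blast
qed

text \<open>
  The variational inequality for the proximal point of a linear functional at \<open>0\<close> says that the
  functional dominates, hence equals, an inner product.
\<close>

lemma riesz_representation:
  fixes l :: "'a::{real_inner, complete_space} \<Rightarrow> real"
  assumes "bounded_linear l"
  obtains D where "\<And>h. l h = inner h D"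
proof -
  interpret bounded_linear l by fact
  let ?g = "\<lambda>w. ereal (l w)"
  have "lower_semicontinuous ?g"
  proof (rule lower_semicontinuousI_less)
    fix w c assume c: "c < ?g w"
    have "(?g \<longlongrightarrow> ?g w) (nhds w)"
      using isCont[OF continuous_ident, of w]
      by (intro tendsto_intros) (simp add: continuous_at tendsto_at_iff_tendsto_nhds)
    then show "\<forall>\<^sub>F v in nhds w. c < ?g v" using c by (rule order_tendstoD(1))
  qed
  moreover have "proper_fun ?g" by (simp add: proper_fun_def)
  moreover have "convex_ereal ?g" by (simp add: convex_ereal_def add scaleR)
  ultimately obtain r where r: "?g (prox ?g 0) = ereal r"
      and v: "\<And>u s. ?g u \<le> ereal s \<Longrightarrow> r + inner (0 - prox ?g 0) (u - prox ?g 0) \<le> s"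
    using prox_variational[of ?g 0] by blast
  define p where "p = prox ?g 0"
  have rp: "r = l p" using r by (simp add: p_def)
  have "l h \<ge> inner h (- p)" for h
    using v[of "p + h" "l (p + h)", folded p_def] by (simp add: rp add inner_commute)
  from this[of h for h] this[of "- h" for h] have "l h = inner h (- p)" for h
    by (smt (verit) inner_minus_left neg)
  then show ?thesis by (rule that)
qed

text \<open>The definite description in \<open>gradient\<close> denotes: Riesz representation gives
  existence, and uniqueness of the Frechet derivative gives uniqueness.\<close>

lemma GDERIV_gradient:
  fixes f :: "'a::{real_inner, complete_space} \<Rightarrow> real"
  assumes "f differentiable (at u)"
  shows "GDERIV f u :> gradient f u"
proof -
  obtain f' where f': "(f has_derivative f') (at u)" using assms by (auto simp: differentiable_def)
  obtain D where "\<And>h. f' h = inner h D"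
    using riesz_representation[OF has_derivative_bounded_linear[OF f']] by blast
  then have "f' = (\<lambda>h. inner h D)" by auto
  with f' have D: "GDERIV f u :> D" by (simp add: gderiv_def)
  have "E = D" if "GDERIV f u :> E" for E
  proof -
    have "(\<lambda>h. inner h E) = (\<lambda>h. inner h D)"
      using that D unfolding gderiv_def by (rule has_derivative_unique)
    then show ?thesis by (simp add: fun_eq_iff vector_eq_ldot)
  qed
  with D show ?thesis unfolding gradient_def by (rule theI)
qed

subsection \<open>Smooth convex functions\<close>

lemma GDERIV_along_line:
  assumes "GDERIV f (u + s *\<^sub>R d) :> D"
  shows "((\<lambda>s. f (u + s *\<^sub>R d)) has_field_derivative inner D d) (at s)"
proof -
  have "((\<lambda>s. u + s *\<^sub>R d) has_derivative (\<lambda>h. h *\<^sub>R d)) (at s)"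
    by (auto intro!: derivative_eq_intros)
  from has_derivative_compose[OF this assms[unfolded gderiv_def]]
  show ?thesis unfolding has_field_derivative_def
    by (rule has_derivative_eq_rhs) (simp add: inner_commute mult.commute fun_eq_iff)
qed

lemma convex_on_GDERIV_tangent:
  assumes "convex_on UNIV f" "GDERIV f u :> D"
  shows "f u + inner D (v - u) \<le> f v"
proof -
  let ?p = "\<lambda>s. f (u + s *\<^sub>R (v - u))"
  have "convex_on UNIV ?p"
  proof (rule convex_onI)
    fix t x y :: real assume t: "0 < t" "t < 1"
    have e: "u + ((1 - t) *\<^sub>R x + t *\<^sub>R y) *\<^sub>R (v - u)
      = (1 - t) *\<^sub>R (u + x *\<^sub>R (v - u)) + t *\<^sub>R (u + y *\<^sub>R (v - u))"
      by (simp add: algebra_simps)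
    show "?p ((1 - t) *\<^sub>R x + t *\<^sub>R y) \<le> (1 - t) * ?p x + t * ?p y"
      unfolding e using t by (intro convex_onD[OF assms(1)]) auto
  qed simp
  moreover have "(?p has_field_derivative inner D (v - u)) (at 0)"
    using assms(2) by (intro GDERIV_along_line) simp
  ultimately have "inner D (v - u) * (1 - 0) \<le> ?p 1 - ?p 0"
    by (intro convex_on_imp_above_tangent[of UNIV]) auto
  then show ?thesis by simp
qed

text \<open>Along the segment from \<open>u\<close> to \<open>v\<close>, the difference between
  \<open>f\<close> and its claimed quadratic upper bound has nonpositive derivative, by
  Cauchy-Schwarz and the Lipschitz condition.\<close>

lemma descent_lemma:
  fixes f :: "'a::real_inner \<Rightarrow> real"
  assumes G: "\<And>w. GDERIV f w :> G w" and L: "L-lipschitz_on UNIV G"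
  shows "f v \<le> f u + inner (G u) (v - u) + L / 2 * (norm (v - u))\<^sup>2"
proof -
  let ?p = "\<lambda>s. f (u + s *\<^sub>R (v - u)) - s * inner (G u) (v - u) - L / 2 * s\<^sup>2 * (norm (v - u))\<^sup>2"
  have "?p 1 \<le> ?p 0"
  proof (rule DERIV_nonpos_imp_nonincreasing[of 0 1 ?p])
    fix s :: real assume s: "0 \<le> s" "s \<le> 1"
    let ?w = "u + s *\<^sub>R (v - u)"
    have "(?p has_field_derivative inner (G ?w) (v - u) - inner (G u) (v - u) - L * s * (norm (v - u))\<^sup>2) (at s)"
      by (rule derivative_eq_intros GDERIV_along_line G refl | simp)+
    moreover have "inner (G ?w) (v - u) - inner (G u) (v - u) - L * s * (norm (v - u))\<^sup>2 \<le> 0"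
    proof -
      have "inner (G ?w) (v - u) - inner (G u) (v - u) \<le> norm (G ?w - G u) * norm (v - u)"
        unfolding inner_diff_left[symmetric] by (rule norm_cauchy_schwarz)
      also have "\<dots> \<le> (L * (s * norm (v - u))) * norm (v - u)"
        using lipschitz_onD[OF L, of ?w u] s by (intro mult_right_mono) (auto simp: dist_norm)
      finally show ?thesis by (simp add: power2_eq_square mult.assoc)
    qed
    ultimately show "\<exists>y. (?p has_field_derivative y) (at s) \<and> y \<le> 0" by blast
  qed simp
  then show ?thesis by simp
qed

subsection \<open>Operations on extended-valued convex functions\<close>

lemma proper_fun_cmult:
  assumes "proper_fun g" "0 < c"
  shows "proper_fun (\<lambda>u. ereal c * g u)"
proof -
  from assms(1) obtain w b where "g w = ereal b" by (rule proper_fun_finite_point)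
  then have "ereal c * g w \<noteq> \<infinity>" by simp
  then show ?thesis using assms unfolding proper_fun_def by (auto simp: ereal_mult_eq_MInfty)
qed

lemma lower_semicontinuous_cmult:
  assumes "lower_semicontinuous g" "0 \<le> c"
  shows "lower_semicontinuous (\<lambda>u. ereal c * g u)"
  unfolding lower_semicontinuous_def
proof
  fix w
  have "ereal c * g w \<le> ereal c * Liminf (nhds w) g"
    using assms unfolding lower_semicontinuous_def by (intro ereal_mult_left_mono) auto
  then show "ereal c * g w \<le> Liminf (nhds w) (\<lambda>u. ereal c * g u)"
    using assms(2) by (subst Liminf_ereal_mult_left) auto
qed

lemma convex_ereal_cmult:
  assumes "convex_ereal g" "0 < c"
  shows "convex_ereal (\<lambda>u. ereal c * g u)"
  unfolding convex_ereal_def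
proof (intro allI impI)
  fix x y and u v :: real assume uv: "0 < u" "0 < v" "u + v = 1"
  have "ereal c * g (u *\<^sub>R x + v *\<^sub>R y) \<le> ereal c * (ereal u * g x + ereal v * g y)"
    using assms uv unfolding convex_ereal_def by (intro ereal_mult_left_mono) auto
  also have "\<dots> = ereal u * (ereal c * g x) + ereal v * (ereal c * g y)"
    using uv assms(2) by (cases "g x"; cases "g y") (auto simp: algebra_simps)
  finally show "ereal c * g (u *\<^sub>R x + v *\<^sub>R y) \<le> ereal u * (ereal c * g x) + ereal v * (ereal c * g y)" .
qed

lemma proper_fun_add_real:
  assumes "proper_fun g"
  shows "proper_fun (\<lambda>u. ereal (f u) + g u)"
  using assms unfolding proper_fun_def by auto

lemma lower_semicontinuous_add_continuous:
  assumes f: "\<And>w. isCont f w" and g: "lower_semicontinuous g" "\<And>w. g w \<noteq> -\<infinity>"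
  shows "lower_semicontinuous (\<lambda>u. ereal (f u) + g u)"
proof (rule lower_semicontinuousI_less)
  fix w c assume c: "c < ereal (f w) + g w"
  \<comment> \<open>The level \<open>c\<close> is split into one threshold for each summand, so that
    the two neighbourhoods can be found separately.\<close>
  have "\<exists>p q. c \<le> ereal p + ereal q \<and> p < f w \<and> ereal q < g w"
  proof (cases c)
    case (real r)
    with c have "ereal (r - f w) < g w" by (cases "g w") auto
    then obtain q where q: "ereal (r - f w) < ereal q" "ereal q < g w" by (rule ereal_dense2[THEN exE]) blast
    then show ?thesis using real by (intro exI[of _ "r - q"] exI[of _ q]) auto
  next
    case MInf
    have "-\<infinity> < g w" using g(2)[of w] by auto
    then obtain q where "ereal q < g w" using ereal_dense2 by blast
    then show ?thesis using MInf by (intro exI[of _ "f w - 1"] exI[of _ q]) auto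
  qed (use c in auto)
  then obtain p q where pq: "c \<le> ereal p + ereal q" "p < f w" "ereal q < g w" by blast
  have "\<forall>\<^sub>F v in nhds w. p < f v"
    using f[of w] pq(2) unfolding isCont_def tendsto_at_iff_tendsto_nhds by (rule order_tendstoD)
  moreover have "\<forall>\<^sub>F v in nhds w. ereal q < g v"
    using g(1) pq(3) unfolding lower_semicontinuous_def
    by (intro less_LiminfD) (auto intro: order.strict_trans2)
  ultimately show "\<forall>\<^sub>F v in nhds w. c < ereal (f v) + g v"
  proof eventually_elim
    case (elim v)
    have "ereal p + ereal q < ereal (f v) + g v" using elim by (cases "g v") auto
    with pq(1) show ?case by (rule order.strict_trans1)
  qed
qed

lemma convex_ereal_add_real:
  assumes f: "convex_on UNIV f" and g: "convex_ereal g" "\<And>w. g w \<noteq> -\<infinity>"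
  shows "convex_ereal (\<lambda>u. ereal (f u) + g u)"
  unfolding convex_ereal_def
proof (intro allI impI)
  fix x y and u v :: real assume uv: "0 < u" "0 < v" "u + v = 1"
  have "f (u *\<^sub>R x + v *\<^sub>R y) \<le> u * f x + v * f y"
    using f uv unfolding convex_on_def by auto
  moreover have "g (u *\<^sub>R x + v *\<^sub>R y) \<le> ereal u * g x + ereal v * g y"
    using g(1) uv unfolding convex_ereal_def by auto
  ultimately have "ereal (f (u *\<^sub>R x + v *\<^sub>R y)) + g (u *\<^sub>R x + v *\<^sub>R y)
    \<le> ereal (u * f x + v * f y) + (ereal u * g x + ereal v * g y)"
    by (intro add_mono) auto
  also have "\<dots> = ereal u * (ereal (f x) + g x) + ereal v * (ereal (f y) + g y)"
    using uv g(2)[of x] g(2)[of y] by (cases "g x"; cases "g y") (auto simp: algebra_simps)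
  finally show "ereal (f (u *\<^sub>R x + v *\<^sub>R y)) + g (u *\<^sub>R x + v *\<^sub>R y)
    \<le> ereal u * (ereal (f x) + g x) + ereal v * (ereal (f y) + g y)" .
qed

subsection \<open>Weak convergence\<close>

text \<open>The weights may tend to 0, but no faster than the harmonic sequence. Their sum diverges,
  and the influence of the starting value dies out.\<close>

lemma convex_averages_tendsto:
  fixes p q b :: "nat \<Rightarrow> real"
  assumes step: "\<And>t. p (Suc t) = (1 - b t) * p t + b t * q (Suc t)"
    and b: "\<And>t. 1 / (real t + 1) \<le> b t" "\<And>t. b t \<le> 1"
    and q: "q \<longlonglongrightarrow> l"
  shows "p \<longlonglongrightarrow> l"
proof (rule tendstoI)
  fix e :: real assume e: "e > 0"
  obtain N where N: "\<And>t. t \<ge> N \<Longrightarrow> \<bar>q t - l\<bar> < e / 2"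
    using tendstoD[OF q, of "e / 2"] e unfolding eventually_sequentially dist_real_def by auto
  \<comment> \<open>The excess of the error over \<open>e / 2\<close>: from \<open>N\<close> on the
    new terms \<open>q\<close> stay within \<open>e / 2\<close> of \<open>l\<close>, so each step
    only contracts this excess.\<close>
  define d where "d t = max 0 (\<bar>p t - l\<bar> - e / 2)" for t
  \<comment> \<open>\<open>1 - b t \<le> t / (t + 1)\<close>, so the product of the contraction factors telescopes.\<close>
  have ds: "real (Suc t) * d (Suc t) \<le> real t * d t" if t: "t \<ge> N" for t
  proof -
    have b0: "0 \<le> b t" by (rule order_trans[OF _ b(1)]) simp
    have "p (Suc t) - l = (1 - b t) * (p t - l) + b t * (q (Suc t) - l)"
      unfolding step by (simp add: algebra_simps)
    also have "\<bar>\<dots>\<bar> \<le> (1 - b t) * \<bar>p t - l\<bar> + b t * \<bar>q (Suc t) - l\<bar>"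
      using b0 b(2)[of t] by (intro order_trans[OF abs_triangle_ineq]) (simp add: abs_mult)
    also have "\<dots> \<le> (1 - b t) * (d t + e / 2) + b t * (e / 2)"
      using b0 b(2)[of t] N[of "Suc t"] t by (intro add_mono mult_left_mono) (auto simp: d_def)
    finally have "\<bar>p (Suc t) - l\<bar> - e / 2 \<le> (1 - b t) * d t" by (simp add: field_simps)
    moreover have "0 \<le> (1 - b t) * d t" using b(2)[of t] by (simp add: d_def)
    ultimately have "d (Suc t) \<le> (1 - b t) * d t" unfolding d_def[of "Suc t"] by simp
    also have "\<dots> \<le> (1 - 1 / (real t + 1)) * d t"
      using b(1)[of t] by (intro mult_right_mono) (auto simp: d_def)
    finally show ?thesis by (simp add: field_simps)
  qed
  have dN: "real t * d t \<le> real N * d N" if "t \<ge> N" for t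
    using that by (induction t rule: dec_induct) (use ds order_trans in \<open>blast+\<close>)
  have "(\<lambda>t. real N * d N / real t) \<longlonglongrightarrow> 0" by (rule lim_const_over_n)
  then have "\<forall>\<^sub>F t in sequentially. real N * d N / real t < e / 2"
    using e by (intro order_tendstoD) auto
  moreover have "\<forall>\<^sub>F t in sequentially. t \<ge> max N 1" by (rule eventually_ge_at_top)
  ultimately show "\<forall>\<^sub>F t in sequentially. dist (p t) l < e"
  proof eventually_elim
    case (elim t)
    then have "d t \<le> real N * d N / real t" using dN[of t] by (simp add: field_simps)
    with elim have "d t < e / 2" by linarith
    then show ?case unfolding d_def dist_real_def by linarith
  qed
qed

text \<open>The limsup of squared distances inherits the midpoint gap from the parallelogram law, so
  it has a minimizer \<open>p\<close>. If \<open>inner (x t - p) h\<close> stayed above some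
  \<open>e > 0\<close>, a small move of \<open>p\<close> along \<open>h\<close> would decrease the
  limsup.\<close>

lemma bounded_seq_asymptotic_centre:
  fixes x :: "nat \<Rightarrow> 'a::{real_inner, complete_space}"
  assumes "bounded (range x)"
  obtains p where "\<And>h e. 0 < e \<Longrightarrow> \<exists>\<^sub>F t in sequentially. inner (x t - p) h < e"
proof -
  obtain M where M: "\<And>t. norm (x t) \<le> M" using assms by (auto simp: bounded_iff)
  define R where "R w = limsup (\<lambda>t. ereal ((norm (x t - w))\<^sup>2))" for w
  \<comment> \<open>Strict eventual bounds turn all estimates on the limsup into estimates on real
    numbers.\<close>
  have R_le: "R w \<le> ereal c \<longleftrightarrow> (\<forall>d>c. \<forall>\<^sub>F t in sequentially. (norm (x t - w))\<^sup>2 < d)" for w c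
  proof
    assume "R w \<le> ereal c"
    then have "\<forall>\<^sub>F t in sequentially. ereal ((norm (x t - w))\<^sup>2) < ereal d" if "d > c" for d
      using that unfolding R_def Limsup_le_iff by (meson less_ereal.simps(1))
    then show "\<forall>d>c. \<forall>\<^sub>F t in sequentially. (norm (x t - w))\<^sup>2 < d" by simp
  next
    assume a: "\<forall>d>c. \<forall>\<^sub>F t in sequentially. (norm (x t - w))\<^sup>2 < d"
    show "R w \<le> ereal c"
      unfolding R_def Limsup_le_iff
    proof (intro allI impI)
      fix y assume "ereal c < y"
      then show "\<forall>\<^sub>F t in sequentially. ereal ((norm (x t - w))\<^sup>2) < y"
        using a by (cases y) auto
    qed
  qed
  have R_bdd: "R p \<le> ereal ((M + norm p)\<^sup>2)" for p
    unfolding R_le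
  proof (intro allI impI always_eventually)
    fix d t assume "d > (M + norm p)\<^sup>2"
    moreover have "norm (x t - p) \<le> M + norm p"
      using norm_triangle_ineq4[of "x t" p] M[of t] by simp
    ultimately show "(norm (x t - p))\<^sup>2 < d" by (meson le_less_trans norm_ge_zero power_mono)
  qed
  obtain p where p: "\<And>w. R p \<le> R w"
  proof (rule midpoint_strongly_convex_minimizer[of 0 R])
    show "ereal 0 \<le> R w" for w
      unfolding R_def by (intro le_Limsup) (auto simp: always_eventually)
    show "R 0 \<noteq> \<infinity>" using R_bdd[of 0] by auto
  next
    fix s p c assume sp: "s \<longlonglongrightarrow> p" and ev: "\<forall>\<^sub>F n in sequentially. R (s n) \<le> ereal c"
    show "R p \<le> ereal c"
      unfolding R_le
    proof (intro allI impI)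
      fix d assume d: "d > c"
      \<comment> \<open>This product bounds, uniformly in \<open>t\<close>, the growth of the
        squared distance to \<open>x t\<close> when the centre moves from \<open>s n\<close> to
        \<open>p\<close>.\<close>
      have "(\<lambda>n. norm (s n - p) * (2 * (M + norm (s n)) + norm (s n - p))) \<longlonglongrightarrow> norm (p - p) * (2 * (M + norm p) + norm (p - p))"
        by (intro tendsto_intros sp)
      then have "\<forall>\<^sub>F n in sequentially. norm (s n - p) * (2 * (M + norm (s n)) + norm (s n - p)) < (d - c) / 2"
        using d by (intro order_tendstoD) auto
      with ev have "\<forall>\<^sub>F n in sequentially. R (s n) \<le> ereal c \<and> norm (s n - p) * (2 * (M + norm (s n)) + norm (s n - p)) < (d - c) / 2"
        by eventually_elim simp
      then obtain n where n: "R (s n) \<le> ereal c" "norm (s n - p) * (2 * (M + norm (s n)) + norm (s n - p)) < (d - c) / 2"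
        using eventually_happens by fastforce
      have "(c + d) / 2 > c" using d by simp
      with n(1) have "\<forall>\<^sub>F t in sequentially. (norm (x t - s n))\<^sup>2 < (c + d) / 2" unfolding R_le by blast
      then show "\<forall>\<^sub>F t in sequentially. (norm (x t - p))\<^sup>2 < d"
      proof eventually_elim
        case (elim t)
        have "norm (x t - p) \<le> norm (x t - s n) + norm (s n - p)"
          using norm_triangle_ineq[of "x t - s n" "s n - p"] by simp
        then have "(norm (x t - p))\<^sup>2 \<le> (norm (x t - s n) + norm (s n - p))\<^sup>2" by (rule power_mono) simp
        also have "\<dots> = (norm (x t - s n))\<^sup>2 + norm (s n - p) * (2 * norm (x t - s n) + norm (s n - p))"
          by (simp add: power2_eq_square algebra_simps)
        also have "\<dots> \<le> (norm (x t - s n))\<^sup>2 + norm (s n - p) * (2 * (M + norm (s n)) + norm (s n - p))"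
          using norm_triangle_ineq4[of "x t" "s n"] M[of t] by (intro add_left_mono mult_left_mono) auto
        finally show ?case using elim n(2) by (simp add: field_simps)
      qed
    qed
  next
    fix u v r s assume uv: "R u \<le> ereal r" "R v \<le> ereal s"
    show "R ((1/2) *\<^sub>R (u + v)) \<le> ereal ((r + s) / 2 - (norm (u - v))\<^sup>2 / 8)"
      unfolding R_le
    proof (intro allI impI)
      fix d assume d: "d > (r + s) / 2 - (norm (u - v))\<^sup>2 / 8"
      define e where "e = d - ((r + s) / 2 - (norm (u - v))\<^sup>2 / 8)"
      have "\<forall>\<^sub>F t in sequentially. (norm (x t - u))\<^sup>2 < r + e" "\<forall>\<^sub>F t in sequentially. (norm (x t - v))\<^sup>2 < s + e"
        using uv d unfolding R_le e_def by auto
      then show "\<forall>\<^sub>F t in sequentially. (norm (x t - (1/2) *\<^sub>R (u + v)))\<^sup>2 < d"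
      proof eventually_elim
        case (elim t)
        have "(norm (x t - (1/2) *\<^sub>R (u + v)))\<^sup>2 = (norm (u - x t))\<^sup>2 / 2 + (norm (v - x t))\<^sup>2 / 2 - (norm (u - v))\<^sup>2 / 4"
          unfolding midpoint_norm_square[symmetric] by (simp add: norm_minus_commute)
        also have "\<dots> \<le> (norm (x t - u))\<^sup>2 / 2 + (norm (x t - v))\<^sup>2 / 2 - (norm (u - v))\<^sup>2 / 8"
          by (simp add: norm_minus_commute)
        also have "\<dots> < d" using elim unfolding e_def by (simp add: field_simps)
        finally show ?case .
      qed
    qed
  qed blast
  have "0 \<le> R p" unfolding R_def by (intro le_Limsup) (auto simp: always_eventually)
  moreover note R_bdd[of p]
  ultimately obtain r where r: "R p = ereal r" by (cases "R p") auto
  have "\<exists>\<^sub>F t in sequentially. inner (x t - p) h < e" if e: "0 < e" for h e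
  proof (rule ccontr)
    assume "\<not> ?thesis"
    then have ev: "\<forall>\<^sub>F t in sequentially. e \<le> inner (x t - p) h"
      by (simp add: not_frequently not_less)
    \<comment> \<open>The step is short enough that the quadratic cost
      \<open>s * (s * (norm h)\<^sup>2)\<close> is at most half of the linear gain
      \<open>2 * s * e\<close>. The added 1 covers \<open>h = 0\<close>.\<close>
    define s where "s = e / ((norm h)\<^sup>2 + 1)"
    have s: "s > 0" using e by (simp add: s_def add_nonneg_pos)
    have se: "s * (norm h)\<^sup>2 \<le> e"
    proof -
      have "s * (norm h)\<^sup>2 \<le> s * ((norm h)\<^sup>2 + 1)" using s by simp
      also have "\<dots> = e" unfolding s_def by (simp add: add_nonneg_eq_0_iff)
      finally show ?thesis .
    qed
    have "R (p + s *\<^sub>R h) \<le> ereal (r - s * e)"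
      unfolding R_le
    proof (intro allI impI)
      fix d assume "d > r - s * e"
      then have "d + s * e > r" by simp
      moreover have "R p \<le> ereal r" using r by simp
      ultimately have "\<forall>\<^sub>F t in sequentially. (norm (x t - p))\<^sup>2 < d + s * e" unfolding R_le by blast
      with ev show "\<forall>\<^sub>F t in sequentially. (norm (x t - (p + s *\<^sub>R h)))\<^sup>2 < d"
      proof eventually_elim
        case (elim t)
        have "(norm (x t - (p + s *\<^sub>R h)))\<^sup>2 = (norm (x t - p))\<^sup>2 - 2 * s * inner (x t - p) h + s * (s * (norm h)\<^sup>2)"
          unfolding power2_norm_eq_inner
          by (simp add: inner_diff inner_add algebra_simps inner_commute)
        also have "\<dots> \<le> (norm (x t - p))\<^sup>2 - 2 * s * e + s * e"
          using s se elim(1) by (intro add_mono diff_left_mono mult_left_mono) auto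
        also have "\<dots> < d" using elim(2) by linarith
        finally show ?case .
      qed
    qed
    with p[of "p + s *\<^sub>R h"] r have "ereal r \<le> ereal (r - s * e)" by (metis order_trans)
    then show False using s e by (simp add: mult_le_0_iff)
  qed
  then show ?thesis by (rule that)
qed

text \<open>
  Testing the variational inequality of the proximal point \<open>q\<close> of \<open>p\<close> along the sequence forces \<open>p = q\<close>.
\<close>

lemma weak_cluster_point_is_minimizer:
  fixes \<Psi> :: "'a::{real_inner, complete_space} \<Rightarrow> ereal"
  assumes \<Psi>: "proper_fun \<Psi>" "lower_semicontinuous \<Psi>" "convex_ereal \<Psi>"
    and lower: "\<And>w. ereal m \<le> \<Psi> w"
    and minimizing: "\<And>e. 0 < e \<Longrightarrow> \<forall>\<^sub>F t in sequentially. \<Psi> (s t) \<le> ereal (m + e)"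
    and cluster: "\<And>h e. 0 < e \<Longrightarrow> \<exists>\<^sub>F t in sequentially. inner (s t - p) h < e"
  shows "\<Psi> p = ereal m"
proof -
  define q where "q = prox \<Psi> p"
  obtain r where r: "\<Psi> q = ereal r"
    and var: "\<And>u c. \<Psi> u \<le> ereal c \<Longrightarrow> r + inner (p - q) (u - q) \<le> c"
    using prox_variational[OF \<Psi>, of p, folded q_def] by blast
  have mr: "m \<le> r" using lower[of q] r by simp
  have le: "r + (norm (p - q))\<^sup>2 \<le> m + e" if e: "0 < e" for e
  proof -
    \<comment> \<open>The direction \<open>q - p\<close> is chosen so that the first condition
      bounds \<open>inner (p - q) (s t - q)\<close> below by
      \<open>(norm (p - q))\<^sup>2 - e / 2\<close>.\<close>
    have "\<exists>\<^sub>F t in sequentially. inner (s t - p) (q - p) < e / 2 \<and> \<Psi> (s t) \<le> ereal (m + e / 2)"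
      using e by (intro frequently_eventually_frequently cluster minimizing) auto
    then obtain t where t: "inner (s t - p) (q - p) < e / 2" "\<Psi> (s t) \<le> ereal (m + e / 2)"
      by (auto dest: frequently_ex)
    have "inner (p - q) (s t - q) = (norm (p - q))\<^sup>2 - inner (s t - p) (q - p)"
      unfolding power2_norm_eq_inner by (simp add: inner_diff inner_commute)
    then show ?thesis using var[OF t(2)] t(1) by simp
  qed
  then have "r + (norm (p - q))\<^sup>2 \<le> m" by (rule field_le_epsilon)
  with mr zero_le_power2[of "norm (p - q)"] have "(norm (p - q))\<^sup>2 = 0" "r = m" by linarith+
  then show ?thesis using r by simp
qed

text \<open>The one-sided cluster property bounds the limit from one side; replacing
  \<open>h\<close> by \<open>- h\<close> gives the other.\<close>

lemma weak_cluster_point_inner_limit: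
  assumes cluster: "\<And>h e. 0 < e \<Longrightarrow> \<exists>\<^sub>F t in sequentially. inner (s t - p) h < e"
    and lim: "(\<lambda>t. inner (s t) h) \<longlonglongrightarrow> l"
  shows "l = inner p h"
proof -
  have le: "l \<le> inner p h" if lim: "(\<lambda>t. inner (s t) h) \<longlonglongrightarrow> l" for h l
  proof (rule field_le_epsilon)
    fix e :: real assume e: "0 < e"
    have "\<forall>\<^sub>F t in sequentially. l - e / 2 < inner (s t) h"
      using e by (intro order_tendstoD(1)[OF lim]) simp
    then have "\<exists>\<^sub>F t in sequentially. inner (s t - p) h < e / 2 \<and> l - e / 2 < inner (s t) h"
      using e by (intro frequently_eventually_frequently cluster) auto
    then obtain t where "inner (s t - p) h < e / 2" "l - e / 2 < inner (s t) h"
      by (auto dest: frequently_ex)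
    then show "l \<le> inner p h + e" by (simp add: inner_diff_left)
  qed
  have "(\<lambda>t. inner (s t) (- h)) \<longlonglongrightarrow> - l" using tendsto_minus[OF lim] by simp
  from le[OF lim] le[OF this] show ?thesis by simp
qed

lemma weakly_convergesI_inner:
  fixes x :: "nat \<Rightarrow> 'a::{real_inner, complete_space}"
  assumes "\<And>h. (\<lambda>t. inner (x t) h) \<longlonglongrightarrow> inner p h"
  shows "weakly_converges x p"
  unfolding weakly_converges_def
proof (intro allI impI)
  fix \<phi> :: "'a \<Rightarrow> real" assume "bounded_linear \<phi>"
  then obtain D where "\<And>h. \<phi> h = inner h D" using riesz_representation by blast
  then show "(\<lambda>n. \<phi> (x n)) \<longlonglongrightarrow> \<phi> p" using assms[of D] by simp
qed

text \<open>Opial's argument: if \<open>x\<close> does not converge weakly to the centre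
  \<open>p\<close>, some subsequence stays away from \<open>p\<close> in one direction
  \<open>h\<close>. That subsequence has its own centre \<open>p'\<close> in \<open>S\<close>, and
  convergence of the inner products with \<open>p' - p\<close> forces \<open>p' = p\<close>, a
  contradiction.\<close>

lemma weakly_converges_opial:
  fixes x :: "nat \<Rightarrow> 'a::{real_inner, complete_space}"
  assumes bdd: "bounded (range x)"
    and cluster: "\<And>r p. strict_mono r \<Longrightarrow>
      (\<And>h e. 0 < e \<Longrightarrow> \<exists>\<^sub>F t in sequentially. inner (x (r t) - p) h < e) \<Longrightarrow> p \<in> S"
    and conv: "\<And>u v. u \<in> S \<Longrightarrow> v \<in> S \<Longrightarrow> convergent (\<lambda>t. inner (x t) (u - v))"
  obtains p where "p \<in> S" "weakly_converges x p"
proof -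
  have ex: "\<exists>p. \<forall>h e. 0 < e \<longrightarrow> (\<exists>\<^sub>F t in sequentially. inner (x (r t) - p) h < e)" for r :: "nat \<Rightarrow> nat"
  proof -
    have "bounded (range (\<lambda>t. x (r t)))" using bdd by (rule bounded_subset) auto
    then show ?thesis by (rule bounded_seq_asymptotic_centre) blast
  qed
  obtain p where p: "\<And>h e. 0 < e \<Longrightarrow> \<exists>\<^sub>F t in sequentially. inner (x t - p) h < e"
    using ex[of "\<lambda>t. t"] by blast
  have pS: "p \<in> S" using cluster[of "\<lambda>t. t" p] p by (simp add: strict_mono_def)
  have lt: "\<forall>\<^sub>F t in sequentially. inner (x t - p) h < e" if e: "0 < e" for h e
  proof (rule ccontr)
    assume "\<not> ?thesis"
    then have "infinite {t. e \<le> inner (x t - p) h}"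
      by (simp add: not_eventually not_less frequently_cofinite[symmetric] cofinite_eq_sequentially)
    then obtain r :: "nat \<Rightarrow> nat" where r: "strict_mono r" "\<And>t. e \<le> inner (x (r t) - p) h"
      using infinite_enumerate by blast
    obtain p' where p': "\<And>h e. 0 < e \<Longrightarrow> \<exists>\<^sub>F t in sequentially. inner (x (r t) - p') h < e"
      using ex[of r] by blast
    have "p' \<in> S" using r(1) p' by (rule cluster)
    then obtain l where l: "(\<lambda>t. inner (x t) (p' - p)) \<longlonglongrightarrow> l"
      using conv pS by (auto simp: convergent_def)
    \<comment> \<open>The same limit is evaluated at \<open>p\<close> along the whole sequence and
      at \<open>p'\<close> along the subsequence.\<close>
    have "l = inner p (p' - p)" by (rule weak_cluster_point_inner_limit[OF p l])
    moreover have "l = inner p' (p' - p)"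
      by (rule weak_cluster_point_inner_limit[OF p'])
        (use LIMSEQ_subseq_LIMSEQ[OF l r(1)] in \<open>auto simp: o_def\<close>)
    ultimately have "inner (p' - p) (p' - p) = 0" by (simp add: inner_diff_left)
    then have "p' = p" by simp
    with p'[OF e, of h] r(2) show False by (auto dest!: frequently_ex simp: not_less[symmetric])
  qed
  have "(\<lambda>t. inner (x t) h) \<longlonglongrightarrow> inner p h" for h
  proof (rule tendstoI)
    fix e :: real assume "0 < e"
    from lt[OF this, of h] lt[OF this, of "- h"]
    show "\<forall>\<^sub>F t in sequentially. dist (inner (x t) h) (inner p h) < e"
      by eventually_elim (auto simp: dist_real_def inner_diff_left)
  qed
  then have "weakly_converges x p" by (rule weakly_convergesI_inner)
  with pS show ?thesis by (rule that)
qed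

lemma weakly_converges_of_diff_tendsto_zero:
  assumes "weakly_converges x p" "(\<lambda>t. y t - x t) \<longlonglongrightarrow> 0"
  shows "weakly_converges y p"
  unfolding weakly_converges_def
proof (intro allI impI)
  fix \<phi> :: "'a \<Rightarrow> real" assume \<phi>: "bounded_linear \<phi>"
  then interpret bounded_linear \<phi> .
  have "(\<lambda>t. \<phi> (x t)) \<longlonglongrightarrow> \<phi> p" using assms(1) \<phi> by (simp add: weakly_converges_def)
  from tendsto_add[OF this tendsto[OF assms(2)]]
  show "(\<lambda>t. \<phi> (y t)) \<longlonglongrightarrow> \<phi> p" by (simp add: add[symmetric] zero)
qed

subsection \<open>Accelerated proximal gradient iterations\<close>

text \<open>The one-step energy estimate adds the descent inequality from \<open>y\<close> to
  \<open>x'\<close>, tangents at \<open>y\<close> towards \<open>x\<close> and \<open>u\<close>,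
  convexity of \<open>g\<close> on the average \<open>x'\<close>, and the variational inequality at
  \<open>z'\<close>. When \<open>\<beta> = 1\<close> the coefficient of \<open>f x + r\<close>
  vanishes, so \<open>r\<close> may be any real and \<open>g x\<close> may be infinite.\<close>

lemma apgd_step:
  fixes f :: "'a::{real_inner, complete_space} \<Rightarrow> real"
  assumes tangent: "\<And>u v. f u + inner (G u) (v - u) \<le> f v"
    and descent: "\<And>u v. f v \<le> f u + inner (G u) (v - u) + L / 2 * (norm (v - u))\<^sup>2"
    and g: "proper_fun g" "lower_semicontinuous g" "convex_ereal g"
    and \<gamma>: "0 < \<gamma>" "\<gamma> * L \<le> 1"
    and \<beta>: "1 \<le> \<beta>"
    and y: "y = (1 - 1 / \<beta>) *\<^sub>R x + (1 / \<beta>) *\<^sub>R z"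
    and z': "z' = prox (\<lambda>u. ereal (\<beta> * \<gamma>) * g u) (z - (\<beta> * \<gamma>) *\<^sub>R G y)"
    and x': "x' = (1 - 1 / \<beta>) *\<^sub>R x + (1 / \<beta>) *\<^sub>R z'"
    and gx: "\<beta> = 1 \<or> g x = ereal r"
  obtains r' where "g x' = ereal r'"
    and "\<And>u s. g u \<le> ereal s \<Longrightarrow>
      \<beta>\<^sup>2 * \<gamma> * (f x' + r') + (norm (z' - u))\<^sup>2 / 2
        \<le> (\<beta>\<^sup>2 - \<beta>) * \<gamma> * (f x + r) + \<beta> * \<gamma> * (f u + s) + (norm (z - u))\<^sup>2 / 2"
proof -
  have bg: "\<beta> * \<gamma> > 0" using \<beta> \<gamma> by simp
  let ?\<phi> = "\<lambda>u. ereal (\<beta> * \<gamma>) * g u"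
  obtain \<rho> where \<rho>: "?\<phi> z' = ereal \<rho>"
    and var: "\<And>u s. ?\<phi> u \<le> ereal s \<Longrightarrow> \<rho> + inner (z - (\<beta> * \<gamma>) *\<^sub>R G y - z') (u - z') \<le> s"
    using prox_variational[of ?\<phi> "z - (\<beta> * \<gamma>) *\<^sub>R G y", folded z']
      proper_fun_cmult[OF g(1) bg] lower_semicontinuous_cmult[OF g(2) less_imp_le[OF bg]]
      convex_ereal_cmult[OF g(3) bg] by blast
  obtain c where c: "g z' = ereal c" "\<beta> * \<gamma> * c = \<rho>"
    using \<rho> \<beta> \<gamma>(1) by (cases "g z'") (auto split: if_splits)
  have "g x' \<le> ereal ((1 - 1 / \<beta>) * r + (1 / \<beta>) * c)"
  proof (cases "\<beta> = 1")
    case True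
    then show ?thesis using c by (simp add: x')
  next
    case False
    then show ?thesis unfolding x' using \<beta> gx c by (intro convex_erealD[OF g(3)]) auto
  qed
  moreover have "g x' \<noteq> -\<infinity>" using g(1) by (simp add: proper_fun_def)
  ultimately obtain r' where r': "g x' = ereal r'" "r' \<le> (1 - 1 / \<beta>) * r + (1 / \<beta>) * c"
    by (cases "g x'") auto
  have "\<beta>\<^sup>2 * \<gamma> * r' \<le> \<beta>\<^sup>2 * \<gamma> * ((1 - 1 / \<beta>) * r + (1 / \<beta>) * c)"
    using r'(2) \<gamma>(1) by (intro mult_left_mono) auto
  also have "\<dots> = (\<beta>\<^sup>2 - \<beta>) * \<gamma> * r + \<beta> * \<gamma> * c"
    using \<beta> by (simp add: field_simps power2_eq_square)
  finally have gpart: "\<beta>\<^sup>2 * \<gamma> * r' \<le> (\<beta>\<^sup>2 - \<beta>) * \<gamma> * r + \<beta> * \<gamma> * c" .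
  \<comment> \<open>\<open>x'\<close> and \<open>y\<close> are the same average with
    \<open>z'\<close> in place of \<open>z\<close>; the factor \<open>1 / \<beta>\<close>, once
    squared, cancels the weight \<open>\<beta>\<^sup>2\<close>.\<close>
  have xy: "x' - y = (1 / \<beta>) *\<^sub>R (z' - z)" unfolding x' y by (simp add: algebra_simps)
  have norm_xy: "norm (x' - y) = norm (z' - z) / \<beta>" unfolding xy norm_scaleR using \<beta> by simp
  \<comment> \<open>A second form of the same vector, which splits the linear term into parts
    directed at \<open>x\<close> and \<open>z'\<close>.\<close>
  have xy2: "x' - y = (1 - 1 / \<beta>) *\<^sub>R (x - y) + (1 / \<beta>) *\<^sub>R (z' - y)"
    unfolding x' by (simp add: algebra_simps)
  have "\<beta>\<^sup>2 * \<gamma> * f x' \<le> \<beta>\<^sup>2 * \<gamma> * (f y + inner (G y) (x' - y) + L / 2 * (norm (x' - y))\<^sup>2)"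
    using descent \<gamma>(1) by (intro mult_left_mono) auto
  also have "\<dots> = \<beta>\<^sup>2 * \<gamma> * (f y + inner (G y) (x' - y)) + \<gamma> * L * ((norm (z' - z))\<^sup>2 / 2)"
    using \<beta> unfolding norm_xy by (simp add: field_simps)
  \<comment> \<open>The step-size condition leaves a quadratic error that the term
    \<open>(norm (z' - z))\<^sup>2 / 2\<close> of the proximal inequality absorbs.\<close>
  also have "\<dots> \<le> \<beta>\<^sup>2 * \<gamma> * (f y + inner (G y) (x' - y)) + 1 * ((norm (z' - z))\<^sup>2 / 2)"
    using \<gamma>(2) by (intro add_left_mono mult_right_mono) auto
  also have "\<beta>\<^sup>2 * \<gamma> * (f y + inner (G y) (x' - y))
    = (\<beta>\<^sup>2 - \<beta>) * \<gamma> * (f y + inner (G y) (x - y)) + \<beta> * \<gamma> * (f y + inner (G y) (z' - y))"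
    using \<beta> unfolding xy2 inner_add_right inner_scaleR_right by (simp add: field_simps power2_eq_square)
  also have "(\<beta>\<^sup>2 - \<beta>) * \<gamma> * (f y + inner (G y) (x - y)) \<le> (\<beta>\<^sup>2 - \<beta>) * \<gamma> * f x"
    using \<beta> \<gamma>(1) tangent by (intro mult_left_mono) (auto simp: power2_eq_square)
  finally have fpart: "\<beta>\<^sup>2 * \<gamma> * f x' \<le> (\<beta>\<^sup>2 - \<beta>) * \<gamma> * f x
      + \<beta> * \<gamma> * (f y + inner (G y) (z' - y)) + (norm (z' - z))\<^sup>2 / 2" by simp
  have "\<beta>\<^sup>2 * \<gamma> * (f x' + r') + (norm (z' - u))\<^sup>2 / 2
        \<le> (\<beta>\<^sup>2 - \<beta>) * \<gamma> * (f x + r) + \<beta> * \<gamma> * (f u + s) + (norm (z - u))\<^sup>2 / 2"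
    if us: "g u \<le> ereal s" for u s
  proof -
    have "?\<phi> u \<le> ereal (\<beta> * \<gamma>) * ereal s"
      using us bg by (intro ereal_mult_left_mono) auto
    then have "\<rho> + inner (z - (\<beta> * \<gamma>) *\<^sub>R G y - z') (u - z') \<le> \<beta> * \<gamma> * s"
      by (intro var) simp
    moreover have "inner (z - (\<beta> * \<gamma>) *\<^sub>R G y - z') (u - z')
      = \<beta> * \<gamma> * inner (G y) (z' - u) + (norm (z' - z))\<^sup>2 / 2 + (norm (z' - u))\<^sup>2 / 2 - (norm (z - u))\<^sup>2 / 2"
      unfolding power2_norm_eq_inner
      by (simp add: inner_diff inner_add inner_commute field_simps)
    ultimately have v: "\<beta> * \<gamma> * c + \<beta> * \<gamma> * inner (G y) (z' - u) + (norm (z' - z))\<^sup>2 / 2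
        + (norm (z' - u))\<^sup>2 / 2 \<le> \<beta> * \<gamma> * s + (norm (z - u))\<^sup>2 / 2"
      using c(2) by linarith
    have "\<beta> * \<gamma> * (f y + inner (G y) (u - y)) \<le> \<beta> * \<gamma> * f u"
      using tangent bg by (intro mult_left_mono) auto
    moreover have "\<beta> * \<gamma> * (f y + inner (G y) (z' - y))
      = \<beta> * \<gamma> * (f y + inner (G y) (u - y)) + \<beta> * \<gamma> * inner (G y) (z' - u)"
      by (simp add: inner_diff_right algebra_simps)
    ultimately show ?thesis using v fpart gpart by (simp add: distrib_left)
  qed
  then show ?thesis using that r'(1) by blast
qed

text \<open>If \<open>a (t + 1)\<close> exceeded \<open>t + 1\<close>, then
  \<open>a (t + 1) * (a (t + 1) - 1)\<close> would exceed \<open>(t + 1) * t\<close>, which is at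
  least \<open>t\<^sup>2\<close>. The bound makes the averaging weights at least harmonic.\<close>

lemma step_sequence_le_index:
  fixes a :: "nat \<Rightarrow> real"
  assumes "a 0 = 0" "\<And>t. t \<ge> 1 \<Longrightarrow> 1 \<le> a t" "\<And>t. (a (t + 1))\<^sup>2 - a (t + 1) \<le> (a t)\<^sup>2"
  shows "a t \<le> real t"
proof (induction t)
  case (Suc t)
  have "0 \<le> a t" using assms(1) assms(2)[of t] by (cases t) auto
  with Suc have sq: "(a t)\<^sup>2 \<le> (real t)\<^sup>2" by (rule power_mono)
  show ?case
  proof (rule ccontr)
    assume "\<not> ?thesis"
    then have "(real t + 1) * real t < a (t + 1) * (a (t + 1) - 1)"
      by (intro mult_strict_mono') auto
    moreover have "a (t + 1) * (a (t + 1) - 1) \<le> (real t)\<^sup>2"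
      using assms(3)[of t] sq by (simp add: power2_eq_square algebra_simps)
    ultimately show False by (simp add: power2_eq_square algebra_simps)
  qed
qed (use assms in simp)

theorem theorem2p8:
  fixes f :: "'a::{real_inner, complete_space} \<Rightarrow> real"
    and g :: "'a \<Rightarrow> ereal"
    and Lf \<gamma> :: real
    and a :: "nat \<Rightarrow> real"
    and x y z :: "nat \<Rightarrow> 'a"
  defines "\<Psi> \<equiv> (\<lambda>u. ereal (f u) + g u)"
  assumes f_convex: "convex_on UNIV f"
    and f_differentiable: "\<And>u. f differentiable (at u)"
    and Lf_pos: "Lf > 0"
    and f_smooth: "Lf-lipschitz_on UNIV (gradient f)"
    and g_proper: "proper_fun g"
    and g_lsc: "lower_semicontinuous g"
    and g_convex: "convex_ereal g"
    and minimizer_exists: "minimizers \<Psi> \<noteq> {}"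
    and gamma: "0 < \<gamma>" "\<gamma> \<le> 1 / Lf"
    and a_zero: "a 0 = 0"
    and a_ge_one: "\<And>t. t \<ge> 1 \<Longrightarrow> a t \<ge> 1"
    and a_step: "\<And>t. (a (t + 1))\<^sup>2 - a (t + 1) \<le> (a t)\<^sup>2"
    and a_unbounded: "filterlim a at_top sequentially"
    and iterates: "apgd f g \<gamma> a x y z"
  shows "bounded (range z) \<and>
    (\<exists>x_star \<in> minimizers \<Psi>. weakly_converges x x_star \<and> weakly_converges y x_star)"
proof -

  \<comment> \<open>One-step energy inequality along the iterates\<close>
  note G = GDERIV_gradient[OF f_differentiable]
  note tangent = convex_on_GDERIV_tangent[OF f_convex G]
  note descent = descent_lemma[OF G f_smooth]
  have z0: "z 0 = x 0"
    and yt: "\<And>t. y t = (1 - 1 / a (Suc t)) *\<^sub>R x t + (1 / a (Suc t)) *\<^sub>R z t"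
    and zt: "\<And>t. z (Suc t) =
      prox (\<lambda>u. ereal (a (Suc t) * \<gamma>) * g u) (z t - (a (Suc t) * \<gamma>) *\<^sub>R gradient f (y t))"
    and xt: "\<And>t. x (Suc t) = (1 - 1 / a (Suc t)) *\<^sub>R x t + (1 / a (Suc t)) *\<^sub>R z (Suc t)"
    using iterates by (auto simp: apgd_def)
  have a1: "1 \<le> a (Suc t)" for t using a_ge_one by simp
  have "a 1 * (a 1 - 1) \<le> 0" using a_step[of 0] a_zero by (simp add: power2_eq_square algebra_simps)
  then have a_1: "a (Suc 0) = 1" using a1[of 0] by (simp add: mult_le_0_iff)
  have gL: "\<gamma> * Lf \<le> 1" using gamma Lf_pos by (simp add: field_simps)
  note step = apgd_step[OF tangent descent g_proper g_lsc g_convex gamma(1) gL a1 yt zt xt]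
  have gm: "g w \<noteq> -\<infinity>" for w using g_proper by (simp add: proper_fun_def)
  define \<rho> where "\<rho> t = real_of_ereal (g (x t))" for t
  \<comment> \<open>\<open>g (x 0)\<close> may be infinite, but \<open>a 1 = 1\<close> removes \<open>x 0\<close> from the first step.\<close>
  have gx: "g (x (Suc t)) = ereal (\<rho> (Suc t))" for t
  proof (induction t)
    case 0
    show ?case by (rule step[of 0 undefined]) (auto simp: a_1 \<rho>_def)
  next
    case (Suc t)
    show ?case by (rule step[of "Suc t" "\<rho> (Suc t)"]) (auto simp: Suc, auto simp: \<rho>_def)
  qed
  \<comment> \<open>At \<open>t = 0\<close> the number \<open>\<rho> 0\<close> may be a mere
    default, but its coefficient is 0 because \<open>a 1 = 1\<close>.\<close>
  have energy_step: "(a (Suc t))\<^sup>2 * \<gamma> * (f (x (Suc t)) + \<rho> (Suc t)) + (norm (z (Suc t) - u))\<^sup>2 / 2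
      \<le> ((a (Suc t))\<^sup>2 - a (Suc t)) * \<gamma> * (f (x t) + \<rho> t) + a (Suc t) * \<gamma> * (f u + s) + (norm (z t - u))\<^sup>2 / 2"
    if gu: "g u \<le> ereal s" for t u s
  proof -
    have "a (Suc t) = 1 \<or> g (x t) = ereal (\<rho> t)" using a_1 gx by (cases t) auto
    then obtain r' where "g (x (Suc t)) = ereal r'"
      "(a (Suc t))\<^sup>2 * \<gamma> * (f (x (Suc t)) + r') + (norm (z (Suc t) - u))\<^sup>2 / 2
      \<le> ((a (Suc t))\<^sup>2 - a (Suc t)) * \<gamma> * (f (x t) + \<rho> t) + a (Suc t) * \<gamma> * (f u + s) + (norm (z t - u))\<^sup>2 / 2"
      by (rule step) (use gu in blast)
    then show ?thesis using gx[of t] by simp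
  qed

  \<comment> \<open>The minimal value and its minimizers\<close>
  obtain u0 where u0: "u0 \<in> minimizers \<Psi>" using minimizer_exists by blast
  have min_le: "\<Psi> u \<le> \<Psi> w" if "u \<in> minimizers \<Psi>" for u w
    using that by (auto simp: minimizers_def is_arg_min_def not_less)
  have "\<Psi> u0 \<noteq> \<infinity>" using min_le[OF u0, of "x (Suc 0)"] gx[of 0] by (auto simp: \<Psi>_def)
  moreover have "\<Psi> u0 \<noteq> -\<infinity>" using gm[of u0] by (simp add: \<Psi>_def)
  ultimately obtain m where m: "\<Psi> u0 = ereal m" by (cases "\<Psi> u0") auto
  have lower: "ereal m \<le> \<Psi> w" for w using min_le[OF u0] m by metis
  have minimizers_iff: "u \<in> minimizers \<Psi> \<longleftrightarrow> \<Psi> u = ereal m" for u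
    using min_le[of u u0] lower m by (auto simp: minimizers_def is_arg_min_def not_less intro: antisym)
  have gmin: "g u \<le> ereal (m - f u)" if "u \<in> minimizers \<Psi>" for u
  proof -
    have "\<Psi> u = ereal m" using that by (simp add: minimizers_iff)
    then show ?thesis by (cases "g u") (auto simp: \<Psi>_def)
  qed

  \<comment> \<open>Monotone energies and boundedness\<close>
  define \<Delta> where "\<Delta> t = f (x t) + \<rho> t - m" for t
  \<comment> \<open>The facts about values and energies start at index 1, since
    \<open>g (x 0)\<close> may be infinite.\<close>
  have \<Psi>x: "\<Psi> (x (Suc t)) = ereal (m + \<Delta> (Suc t))" for t
    using gx[of t] by (simp add: \<Psi>_def \<Delta>_def)
  have \<Delta>0: "0 \<le> \<Delta> (Suc t)" for t using lower[of "x (Suc t)"] \<Psi>x[of t] by simp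
  define E where "E u t = (a t)\<^sup>2 * \<gamma> * \<Delta> t + (norm (z t - u))\<^sup>2 / 2" for u t
  have E0: "0 \<le> E u (Suc t)" for u t
    unfolding E_def using \<Delta>0[of t] gamma(1) by simp
  have Edec: "decseq (\<lambda>t. E u (Suc t))" if u: "u \<in> minimizers \<Psi>" for u
  proof (rule decseq_SucI)
    fix n let ?t = "Suc n"
    \<comment> \<open>With \<open>s = m - f u\<close> the comparison value is \<open>m\<close>; its
      multiples cancel because the weights \<open>a\<^sup>2 - a\<close> and \<open>a\<close> add up
      to \<open>a\<^sup>2\<close>.\<close>
    have "E u (Suc ?t) \<le> ((a (Suc ?t))\<^sup>2 - a (Suc ?t)) * \<gamma> * \<Delta> ?t + (norm (z ?t - u))\<^sup>2 / 2"
      using energy_step[OF gmin[OF u], of ?t] by (simp add: E_def \<Delta>_def algebra_simps)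
    also have "\<dots> \<le> (a ?t)\<^sup>2 * \<gamma> * \<Delta> ?t + (norm (z ?t - u))\<^sup>2 / 2"
      using a_step[of ?t] gamma(1) \<Delta>0[of n] by (intro add_right_mono mult_right_mono) auto
    finally show "E u (Suc ?t) \<le> E u ?t" by (simp add: E_def)
  qed
  have Econv: "convergent (\<lambda>t. E u (Suc t))" if u: "u \<in> minimizers \<Psi>" for u
    using decseq_convergent[OF Edec[OF u] allI[OF E0]] by (metis convergentI)
  define C where "C = E u0 (Suc 0)"
  have EC: "E u0 (Suc t) \<le> C" for t
    unfolding C_def using decseqD[OF Edec[OF u0], of 0 t] by simp
  \<comment> \<open>The second entry comes from the energy bound from index 1 on, the first covers
    \<open>z 0\<close>. As \<open>x 0 = z 0\<close> and \<open>x\<close> averages the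
    \<open>z\<close>, the same \<open>B\<close> bounds \<open>x\<close>.\<close>
  define B where "B = max (norm (z 0)) (sqrt (2 * C) + norm u0)"
  have zB: "norm (z t) \<le> B" for t
  proof (cases t)
    case (Suc n)
    have "0 \<le> (a (Suc n))\<^sup>2 * \<gamma> * \<Delta> (Suc n)" using \<Delta>0[of n] gamma(1) by simp
    then have "(norm (z (Suc n) - u0))\<^sup>2 \<le> 2 * C" using EC[of n] unfolding E_def by linarith
    then have "norm (z (Suc n) - u0) \<le> sqrt (2 * C)" by (rule real_le_rsqrt)
    then show ?thesis
      using norm_triangle_sub[of "z (Suc n)" u0] unfolding B_def Suc by simp
  qed (simp add: B_def)
  have z_bdd: "bounded (range z)" using zB by (auto simp: bounded_iff)
  have xB: "norm (x t) \<le> B" for t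
  proof (induction t)
    case 0
    show ?case using zB[of 0] z0 by simp
  next
    case (Suc t)
    have "norm (x (Suc t)) \<le> (1 - 1 / a (Suc t)) * norm (x t) + (1 / a (Suc t)) * norm (z (Suc t))"
      unfolding xt[of t] using a1[of t] by (intro order_trans[OF norm_triangle_ineq]) simp
    also have "\<dots> \<le> (1 - 1 / a (Suc t)) * B + (1 / a (Suc t)) * B"
      using a1[of t] Suc zB by (intro add_mono mult_left_mono) auto
    finally show ?case by (simp add: algebra_simps)
  qed
  have x_bdd: "bounded (range x)" using xB by (auto simp: bounded_iff)

  \<comment> \<open>Convergence of the function values\<close>
  have minimizing: "\<forall>\<^sub>F t in sequentially. \<Psi> (x t) \<le> ereal (m + e)" if e: "0 < e" for e
  proof -
    \<comment> \<open>Since \<open>a t \<le> (a t)\<^sup>2\<close>, this threshold gives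
      \<open>C < (a t)\<^sup>2 * \<gamma> * e\<close>; the summand 1 makes the inequality
      strict.\<close>
    have "\<forall>\<^sub>F t in sequentially. 1 + C / (\<gamma> * e) \<le> a t"
      using a_unbounded by (auto simp: filterlim_at_top)
    moreover have "\<forall>\<^sub>F t in sequentially. 1 \<le> t" by (rule eventually_ge_at_top)
    ultimately show ?thesis
    proof eventually_elim
      case (elim t)
      then obtain n where n: "t = Suc n" by (cases t) auto
      have "C < \<gamma> * e * (1 + C / (\<gamma> * e))" using e gamma(1) by (simp add: field_simps)
      also have "\<dots> \<le> \<gamma> * e * (a t)\<^sup>2"
      proof (rule mult_left_mono)
        have "a t * 1 \<le> a t * a t" using a1[of n] n by (intro mult_left_mono) auto
        then show "1 + C / (\<gamma> * e) \<le> (a t)\<^sup>2" using elim(1) by (simp add: power2_eq_square)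
      qed (use e gamma in simp)
      finally have "C < ((a t)\<^sup>2 * \<gamma>) * e" by (simp add: mult_ac)
      moreover have "((a t)\<^sup>2 * \<gamma>) * \<Delta> t \<le> C"
        using EC[of n] zero_le_power2[of "norm (z (Suc n) - u0)"] unfolding n E_def by linarith
      ultimately have "((a t)\<^sup>2 * \<gamma>) * \<Delta> t \<le> ((a t)\<^sup>2 * \<gamma>) * e" by linarith
      moreover have "0 < (a t)\<^sup>2 * \<gamma>" using a1[of n] gamma(1) n by simp
      ultimately have "\<Delta> t \<le> e" by (rule mult_left_le_imp_le)
      then show ?case using \<Psi>x[of n] n by simp
    qed
  qed

  have "isCont f w" for w using differentiable_imp_continuous_within[OF f_differentiable] .
  then have \<Psi>: "proper_fun \<Psi>" "lower_semicontinuous \<Psi>" "convex_ereal \<Psi>"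
    unfolding \<Psi>_def
    using proper_fun_add_real[OF g_proper] lower_semicontinuous_add_continuous[OF _ g_lsc gm]
      convex_ereal_add_real[OF f_convex g_convex gm] by auto

  \<comment> \<open>Weak convergence of \<open>x\<close>, then of \<open>y\<close>\<close>
  obtain p where p: "p \<in> minimizers \<Psi>" "weakly_converges x p"
  proof (rule weakly_converges_opial[OF x_bdd])
    fix r :: "nat \<Rightarrow> nat" and p
    assume r: "strict_mono r" and
      cl: "\<And>h e. 0 < e \<Longrightarrow> \<exists>\<^sub>F t in sequentially. inner (x (r t) - p) h < e"
    have "\<forall>\<^sub>F t in sequentially. \<Psi> (x (r t)) \<le> ereal (m + e)" if "0 < e" for e
      using minimizing[OF that] filterlim_subseq[OF r] by (rule eventually_compose_filterlim)
    from weak_cluster_point_is_minimizer[OF \<Psi> lower this cl]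
    show "p \<in> minimizers \<Psi>" by (simp add: minimizers_iff)
  next
    fix u v assume u: "u \<in> minimizers \<Psi>" and v: "v \<in> minimizers \<Psi>"
    \<comment> \<open>Both energies contain the same multiple of \<open>\<Delta>\<close>, and the
      squares of \<open>z\<close> cancel too, leaving a linear expression in
      \<open>z\<close>.\<close>
    have "E v (Suc t) - E u (Suc t) + (inner u u - inner v v) / 2 = inner (z (Suc t)) (u - v)" for t
      unfolding E_def power2_norm_eq_inner by (simp add: inner_diff inner_commute field_simps)
    moreover have "convergent (\<lambda>t. E v (Suc t) - E u (Suc t) + (inner u u - inner v v) / 2)"
      by (intro convergent_add convergent_diff Econv u v convergent_const)
    ultimately have "convergent (\<lambda>t. inner (z (Suc t)) (u - v))" by simp
    then obtain l where "(\<lambda>t. inner (z (Suc t)) (u - v)) \<longlonglongrightarrow> l" by (auto simp: convergent_def)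
    then have l: "(\<lambda>t. inner (z t) (u - v)) \<longlonglongrightarrow> l" by (rule LIMSEQ_imp_Suc)
    have "(\<lambda>t. inner (x t) (u - v)) \<longlonglongrightarrow> l"
    proof (rule convex_averages_tendsto[OF _ _ _ l])
      show "inner (x (Suc t)) (u - v)
        = (1 - 1 / a (Suc t)) * inner (x t) (u - v) + 1 / a (Suc t) * inner (z (Suc t)) (u - v)" for t
        unfolding xt[of t] by (simp add: inner_add_left)
      show "1 / (real t + 1) \<le> 1 / a (Suc t)" for t
        using step_sequence_le_index[OF a_zero a_ge_one a_step, of "Suc t"] a1[of t]
        by (intro divide_left_mono) auto
      show "1 / a (Suc t) \<le> 1" for t using a1[of t] by simp
    qed
    then show "convergent (\<lambda>t. inner (x t) (u - v))" by (auto simp: convergent_def)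
  qed blast

  have "(\<lambda>t. y t - x t) \<longlonglongrightarrow> 0"
  proof (rule Lim_null_comparison)
    show "\<forall>\<^sub>F t in sequentially. norm (y t - x t) \<le> 2 * B / a (Suc t)"
    proof (intro always_eventually allI)
      fix t
      \<comment> \<open>The numerator is bounded by \<open>2 * B\<close>, while the denominator
        tends to infinity.\<close>
      have "y t - x t = (1 / a (Suc t)) *\<^sub>R (z t - x t)" unfolding yt by (simp add: algebra_simps)
      then have "norm (y t - x t) = norm (z t - x t) / a (Suc t)" using a1[of t] by simp
      also have "\<dots> \<le> 2 * B / a (Suc t)"
        using norm_triangle_ineq4[of "z t" "x t"] zB[of t] xB[of t] a1[of t]
        by (intro divide_right_mono) auto
      finally show "norm (y t - x t) \<le> 2 * B / a (Suc t)" .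
    qed
    have "filterlim (\<lambda>t. a (Suc t)) at_top sequentially"
      using a_unbounded by (rule filterlim_compose) (rule filterlim_Suc)
    then show "(\<lambda>t. 2 * B / a (Suc t)) \<longlonglongrightarrow> 0"
      by (intro real_tendsto_divide_at_top[OF tendsto_const])
  qed
  with p(2) have "weakly_converges y p" by (rule weakly_converges_of_diff_tendsto_zero)
  with z_bdd p show ?thesis by blast
qed

end
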